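(* For every positive integer $n$, $$\sum_{\substack{\pi\in\mathfrak{S}_n\\ \pi\ \text{cyclically } 123\text{-avoiding}}} 2^{\mathbf{bb}^c(\pi)} = n!.$$
   Context: A permutation $\pi\in\mathfrak{S}_n$ is cyclically $123$-avoiding if there is no index $1\le i\le n$ with $\pi_i<\pi_{i+1}<\pi_{i+2}$ (indices modulo $n$), i.e. it has no cyclic double ascent. The number of cyclic double descents is $\mathbf{bb}^c(\pi)=\#\{i\in\{1,\ldots,n\}: \pi_i>\pi_{i+1}>\pi_{i+2}\}$, indices modulo $n$. *)

theory Defs
  imports Main "HOL-Combinatorics.Permutations"
begin

text \<open>Positions are the elements of \<open>{1..n}\<close>, read modulo \<open>n\<close>: the successor of \<open>n\<close> is \<open>1\<close>.\<close>

definition cyc_succ :: "nat \<Rightarrow> nat \<Rightarrow> nat" where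
  "cyc_succ n i = i mod n + 1"

definition cyclically_123_avoiding :: "nat \<Rightarrow> (nat \<Rightarrow> nat) \<Rightarrow> bool" where
  "cyclically_123_avoiding n \<pi> \<longleftrightarrow>
     \<not> (\<exists>i\<in>{1..n}. \<pi> i < \<pi> (cyc_succ n i) \<and>
                   \<pi> (cyc_succ n i) < \<pi> (cyc_succ n (cyc_succ n i)))"

definition cyc_double_descents :: "nat \<Rightarrow> (nat \<Rightarrow> nat) \<Rightarrow> nat" where
  "cyc_double_descents n \<pi> =
     card {i\<in>{1..n}. \<pi> i > \<pi> (cyc_succ n i) \<and>
                     \<pi> (cyc_succ n i) > \<pi> (cyc_succ n (cyc_succ n i))}"

end

theory Submission
  imports Defs "HOL-Combinatorics.Multiset_Permutations"
begin

text \<open>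
  Give every cyclically consecutive triple the weight 0 (ascending), 2 (descending) or 1 (otherwise).
  The sum in question is the sum of the products of these weights over all permutations.
  By rotation invariance it is \<open>n\<close> times the sum over the permutations with \<open>\<pi> n = n\<close>, i.e. over
  the words \<open>w\<close> on the remaining \<open>n - 1\<close> letters, put between two letters larger than all of \<open>w\<close>.
  Split such a word as \<open>w = u M v\<close> at its maximum \<open>M\<close>. Then \<open>M\<close> serves as a large boundary letter
  for \<open>u\<close> and \<open>v\<close>, and the triple centred at \<open>M\<close> contributes 2 if only \<open>u\<close> is empty, 0 if only
  \<open>v\<close> is empty, and 1 otherwise. The two exceptional cases have the same number of words and average
  weight 1, so inductively the total weight is the number of words.
\<close>

section \<open>Weights of words and boundary letters\<close>

definition triple_weight :: "'a::linorder \<Rightarrow> 'a \<Rightarrow> 'a \<Rightarrow> nat" where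
  "triple_weight x y z = (if x < y \<and> y < z then 0 else if x > y \<and> y > z then 2 else 1)"

fun list_weight :: "'a::linorder list \<Rightarrow> nat" where
  "list_weight (x # y # z # zs) = triple_weight x y z * list_weight (y # z # zs)"
| "list_weight _ = 1"

text \<open>The two factors overlap in exactly two letters, so every consecutive triple lies in
  exactly one of them.\<close>

lemma list_weight_append:
  "list_weight (xs @ x # y # ys) = list_weight (xs @ [x, y]) * list_weight (x # y # ys)"
proof (induction xs rule: list_weight.induct)
  case (1 a b c zs)
  then show ?case by simp
next
  case ("2_3" v w)
  then show ?case by (cases ys) simp_all
qed (cases ys; simp)+

text \<open>Only the final triple contains the last letter. Since that letter exceeds
  \<open>x\<close>, the triple has weight 0 or 1 according to how \<open>x\<close> compares with the
  letter before it.\<close>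

lemma list_weight_change_last:
  assumes "x < b" "x < b'"
  shows "list_weight (xs @ [x, b]) = list_weight (xs @ [x, b'])"
proof (cases xs rule: rev_cases)
  case (snoc ys y)
  then show ?thesis
    using assms list_weight_append[of ys y x "[b]"] list_weight_append[of ys y x "[b']"]
    by (auto simp: triple_weight_def)
qed simp

text \<open>Boundary letters matter only through being larger than their neighbours. This lets the
  maximum of a word take over the role of the outer boundary letter.\<close>

lemma list_weight_change_ends:
  assumes "\<forall>x\<in>set u. x < a \<and> x < b \<and> x < a' \<and> x < b'"
  shows "list_weight (a # u @ [b]) = list_weight (a' # u @ [b'])"
proof (cases u rule: rev_cases)
  case (snoc v x)
  have "list_weight (a # u @ [b]) = list_weight (a # u @ [b'])"
    using list_weight_change_last[of x b b' "a # v"] assms snoc by simp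
  also have "\<dots> = list_weight (a' # u @ [b'])"
  proof (cases u)
    case (Cons y ys)
    then show ?thesis
      using assms by (cases "ys @ [b']") (auto simp: triple_weight_def)
  qed simp
  finally show ?thesis .
qed simp

text \<open>Only the triple centred at \<open>M\<close> lies neither in \<open>T u M\<close> nor in
  \<open>M v T\<close>. Its outer letters come from \<open>u\<close> and \<open>v\<close>, below
  \<open>M\<close>, or are copies of \<open>T\<close>, above \<open>M\<close>; this gives the four
  cases.\<close>

lemma list_weight_split_max:
  assumes "\<forall>x\<in>set u \<union> set v. x < M" "M < T"
  shows "list_weight (T # (u @ M # v) @ [T]) =
           (if u = [] \<and> v = [] then 1 else if u = [] then 2 else if v = [] then 0 else 1) *
           (list_weight (T # u @ [T]) * list_weight (T # v @ [T]))"
proof -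
  have u: "list_weight (T # u @ [M]) = list_weight (T # u @ [T])"
    using assms less_trans[of _ M T] by (intro list_weight_change_ends) auto
  have v: "list_weight (M # v @ [T]) = list_weight (T # v @ [T])"
    using assms less_trans[of _ M T] by (intro list_weight_change_ends) auto
  show ?thesis
  proof (cases "u = []")
    case True
    then show ?thesis
      using v assms by (cases v) (auto simp: triple_weight_def)
  next
    case False
    then obtain u' x where x: "u = u' @ [x]" by (cases u rule: rev_cases) auto
    have *: "list_weight (T # (u @ M # v) @ [T]) =
        list_weight (T # u @ [M]) * list_weight (x # M # v @ [T])"
      using list_weight_append[of "T # u'" x M "v @ [T]"] x by simp
    have "list_weight (x # M # v @ [T]) = (if v = [] then 0 else 1) * list_weight (M # v @ [T])"
      using assms x by (cases v) (auto simp: triple_weight_def)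
    then show ?thesis using * u v False by simp
  qed
qed

section \<open>Summing over all words on a set\<close>

text \<open>A word is cut at its only occurrence of \<open>M\<close>, and \<open>A\<close> collects
  the letters to the left. Besides the weight, \<open>f\<close> will also be the constant 1, to
  count words.\<close>

lemma sum_permutations_of_set_insert:
  assumes "finite S" "M \<notin> S"
  shows "(\<Sum>w\<in>permutations_of_set (insert M S). f w) =
    (\<Sum>A\<in>Pow S. \<Sum>u\<in>permutations_of_set A. \<Sum>v\<in>permutations_of_set (S - A). f (u @ M # v))"
proof -
  let ?D = "SIGMA A:Pow S. permutations_of_set A \<times> permutations_of_set (S - A)"
  have "(\<Sum>w\<in>permutations_of_set (insert M S). f w) = (\<Sum>(A, u, v)\<in>?D. f (u @ M # v))"
  proof (rule sum.reindex_bij_witness[where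
        i = "\<lambda>(A, u, v). u @ M # v" and
        j = "\<lambda>w. (set (takeWhile (\<lambda>x. x \<noteq> M) w), takeWhile (\<lambda>x. x \<noteq> M) w,
                 tl (dropWhile (\<lambda>x. x \<noteq> M) w))"], goal_cases)
    case (1 w)
    then have "M \<in> set w" by (auto simp: permutations_of_set_def)
    then obtain u v where "w = u @ M # v" "M \<notin> set u" by (meson split_list_first)
    then show ?case by (auto simp: takeWhile_append dropWhile_append)
  next
    case (2 w)
    then have "M \<in> set w" by (auto simp: permutations_of_set_def)
    then obtain u v where w: "w = u @ M # v" "M \<notin> set u" by (meson split_list_first)
    then have *: "takeWhile (\<lambda>x. x \<noteq> M) w = u" "tl (dropWhile (\<lambda>x. x \<noteq> M) w) = v"
      by (auto simp: takeWhile_append dropWhile_append)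
    show ?case using 2 w assms unfolding * by (auto simp: permutations_of_set_def)
  next
    case (3 t)
    then obtain A u v where t: "t = (A, u, v)" "set u = A" "A \<subseteq> S"
      by (auto simp: permutations_of_set_def)
    then have "M \<notin> set u" using assms by auto
    then show ?case using t by (auto simp: takeWhile_append dropWhile_append)
  next
    case (4 t)
    then show ?case using assms by (auto simp: permutations_of_set_def)
  next
    case (5 w)
    then have "M \<in> set w" by (auto simp: permutations_of_set_def)
    then obtain u v where "w = u @ M # v" "M \<notin> set u" by (meson split_list_first)
    then show ?case by (auto simp: takeWhile_append dropWhile_append)
  qed
  also have "\<dots> = (\<Sum>A\<in>Pow S. \<Sum>(u, v)\<in>permutations_of_set A \<times> permutations_of_set (S - A).
                     f (u @ M # v))"
    using assms by (subst sum.Sigma) (auto simp: finite_subset intro!: sum.cong)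
  finally show ?thesis by (simp add: sum.cartesian_product)
qed

lemma sum_list_weight_permutations_of_set:
  assumes "finite S" "\<forall>x\<in>S. x < T"
  shows "(\<Sum>w\<in>permutations_of_set S. list_weight (T # w @ [T])) = fact (card S)"
  using assms
proof (induction "card S" arbitrary: S rule: less_induct)
  case less
  show ?case
  proof (cases "S = {}")
    case False
    define M where "M = Max S"
    define R where "R = S - {M}"
    have "M \<in> S" unfolding M_def using False less.prems by (intro Max_in) auto
    then have S: "S = insert M R" "M \<notin> R" "finite R"
      using less.prems by (auto simp: R_def)
    have R: "x < M" if "x \<in> R" for x
      using that less.prems Max_ge[of S x] unfolding R_def M_def by (auto simp: order.order_iff_strict)
    have "M < T" using less.prems S by auto
    \<comment> \<open>The weight of the triple centred at \<open>M\<close>, written in terms of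
      \<open>A\<close>: \<open>u\<close> is empty iff \<open>A = {}\<close>, and \<open>v\<close>
      iff \<open>A = R\<close>. Hence it is constant in the inner double sum.\<close>
    define c :: "'a set \<Rightarrow> nat" where
      "c A = (if A = {} \<and> R = {} then 1 else if A = {} then 2 else if A = R then 0 else 1)" for A
    let ?p = "\<lambda>A. fact (card A) * fact (card (R - A)) :: nat"
    have fin: "finite A" if "A \<subseteq> R" for A using that S finite_subset by blast
    have "(\<Sum>u\<in>permutations_of_set A. \<Sum>v\<in>permutations_of_set (R - A).
             list_weight (T # (u @ M # v) @ [T])) = c A * ?p A" if A: "A \<subseteq> R" for A
    proof -
      have "card A < card S" "card (R - A) < card S"
        using A S by (auto simp: less_Suc_eq_le card_mono)
      then have IH: "(\<Sum>w\<in>permutations_of_set A. list_weight (T # w @ [T])) = fact (card A)"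
        "(\<Sum>w\<in>permutations_of_set (R - A). list_weight (T # w @ [T])) = fact (card (R - A))"
        using A S fin less.prems less.hyps[of A] less.hyps[of "R - A"] by auto
      have "(\<Sum>u\<in>permutations_of_set A. \<Sum>v\<in>permutations_of_set (R - A).
             list_weight (T # (u @ M # v) @ [T])) =
         (\<Sum>u\<in>permutations_of_set A. \<Sum>v\<in>permutations_of_set (R - A).
             c A * (list_weight (T # u @ [T]) * list_weight (T # v @ [T])))"
      proof (intro sum.cong refl, goal_cases)
        case (1 u v)
        then have uv: "set u = A" "set v = R - A" by (auto simp: permutations_of_set_def)
        have "c A = (if u = [] \<and> v = [] then 1 else if u = [] then 2 else if v = [] then 0 else 1)"
          using uv A by (auto simp: c_def)
        moreover have "\<forall>x\<in>set u \<union> set v. x < M" using uv A R by auto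
        ultimately show ?case
          using list_weight_split_max[of u v M T] \<open>M < T\<close> by (simp only:)
      qed
      also have "\<dots> = c A * ((\<Sum>u\<in>permutations_of_set A. list_weight (T # u @ [T])) *
          (\<Sum>v\<in>permutations_of_set (R - A). list_weight (T # v @ [T])))"
        by (simp only: sum_product) (simp only: sum_distrib_left)
      finally show ?thesis unfolding IH .
    qed
    then have *: "(\<Sum>w\<in>permutations_of_set S. list_weight (T # w @ [T])) = (\<Sum>A\<in>Pow R. c A * ?p A)"
      unfolding S(1) sum_permutations_of_set_insert[OF S(3,2)] by (intro sum.cong) auto
    also have "\<dots> = (\<Sum>A\<in>Pow R. ?p A)"
    proof (cases "R = {}")
      case True
      then show ?thesis by (simp add: c_def)
    next
      case False
      \<comment> \<open>The distinct sets \<open>{}\<close> and \<open>R\<close> have the same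
        \<open>?p\<close>, so their coefficients 2 and 0 can be replaced by 1 and 1.\<close>
      have Pow: "Pow R = insert {} (insert R (Pow R - {{}, R}))" by auto
      have "(\<Sum>A\<in>Pow R - {{}, R}. c A * ?p A) = (\<Sum>A\<in>Pow R - {{}, R}. ?p A)"
        using False by (intro sum.cong) (auto simp: c_def)
      then show ?thesis
        using False S(3) by (subst (1 2) Pow) (simp add: c_def)
    qed
    \<comment> \<open>The splitting formula, read backwards with \<open>f\<close> constantly
      1.\<close>
    also have "\<dots> = (\<Sum>w\<in>permutations_of_set S. 1)"
      unfolding S(1) sum_permutations_of_set_insert[OF S(3,2)]
      by (intro sum.cong) (auto simp: fin)
    also have "\<dots> = fact (card S)" using less.prems by simp
    finally show ?thesis .
  qed simp
qed

section \<open>From words to functions on positions\<close>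

lemma list_weight_map_upt:
  "list_weight (map h [m..<m + k]) =
     (\<Prod>i = m..<m + k - 2. triple_weight (h i) (h (i + 1)) (h (i + 2)))"
proof (induction k arbitrary: m)
  case (Suc k)
  show ?case
  proof (cases "k < 2")
    case True
    then have "k = 0 \<or> k = 1" by auto
    then show ?thesis by auto
  next
    case False
    then obtain l where l: "k = Suc (Suc l)" by (metis add_2_eq_Suc' le_add_diff_inverse2 not_less)
    have "[m..<m + Suc k] = m # Suc m # Suc (Suc m) # [m + 3..<m + Suc k]"
      and "[Suc m..<Suc m + k] = Suc m # Suc (Suc m) # [m + 3..<m + Suc k]"
      using l by (simp_all add: upt_rec eval_nat_numeral)
    then have "list_weight (map h [m..<m + Suc k]) =
        triple_weight (h m) (h (m + 1)) (h (m + 2)) * list_weight (map h [Suc m..<Suc m + k])"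
      by simp
    also have "\<dots> = (\<Prod>i = m..<m + Suc k - 2. triple_weight (h i) (h (i + 1)) (h (i + 2)))"
      unfolding Suc.IH using l by (subst (2) prod.atLeast_Suc_lessThan) auto
    finally show ?thesis .
  qed
qed simp

lemma bij_betw_map_permutes:
  assumes "distinct xs"
  shows "bij_betw (\<lambda>\<pi>. map \<pi> xs) {\<pi>. \<pi> permutes set xs} (permutations_of_set (set xs))"
proof -
  have inj: "inj_on (\<lambda>\<pi>. map \<pi> xs) {\<pi>. \<pi> permutes set xs}"
  proof (rule inj_onI, clarify)
    fix \<pi> \<sigma> assume "\<pi> permutes set xs" "\<sigma> permutes set xs" "map \<pi> xs = map \<sigma> xs"
    then show "\<pi> = \<sigma>" by (metis ext map_eq_conv permutes_not_in)
  qed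
  moreover have "(\<lambda>\<pi>. map \<pi> xs) ` {\<pi>. \<pi> permutes set xs} = permutations_of_set (set xs)"
  \<comment> \<open>Surjectivity by counting: both sets have \<open>fact (card (set xs))\<close>
    elements.\<close>
  proof (rule card_subset_eq)
    show "(\<lambda>\<pi>. map \<pi> xs) ` {\<pi>. \<pi> permutes set xs} \<subseteq> permutations_of_set (set xs)"
      using assms by (auto simp: permutations_of_set_def distinct_map permutes_in_image
          permutes_inj_on permutes_image)
    show "card ((\<lambda>\<pi>. map \<pi> xs) ` {\<pi>. \<pi> permutes set xs}) = card (permutations_of_set (set xs))"
      using inj by (simp add: card_image card_permutations)
  qed simp
  ultimately show ?thesis by (simp add: bij_betw_def)
qed

section \<open>The cyclic weight and its rotation invariance\<close>

definition cyc_weight :: "nat \<Rightarrow> (nat \<Rightarrow> nat) \<Rightarrow> nat" where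
  "cyc_weight n \<pi> =
     (\<Prod>i\<in>{1..n}. triple_weight (\<pi> i) (\<pi> (cyc_succ n i)) (\<pi> (cyc_succ n (cyc_succ n i))))"

lemma cyc_weight_eq:
  "cyc_weight n \<pi> = (if cyclically_123_avoiding n \<pi> then 2 ^ cyc_double_descents n \<pi> else 0)"
proof (cases "cyclically_123_avoiding n \<pi>")
  case True
  let ?D = "\<lambda>i. \<pi> i > \<pi> (cyc_succ n i) \<and> \<pi> (cyc_succ n i) > \<pi> (cyc_succ n (cyc_succ n i))"
  have "cyc_weight n \<pi> = (\<Prod>i\<in>{1..n}. if ?D i then 2 else 1)"
    using True unfolding cyc_weight_def cyclically_123_avoiding_def
    by (intro prod.cong) (auto simp: triple_weight_def)
  also have "\<dots> = (\<Prod>i\<in>{i\<in>{1..n}. ?D i}. 2)"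
    by (rule prod.inter_filter[symmetric]) simp
  finally show ?thesis using True by (simp add: cyc_double_descents_def)
next
  case False
  then obtain i where "i \<in> {1..n}"
    "triple_weight (\<pi> i) (\<pi> (cyc_succ n i)) (\<pi> (cyc_succ n (cyc_succ n i))) = 0"
    unfolding cyclically_123_avoiding_def triple_weight_def by auto
  then have "cyc_weight n \<pi> = 0"
    unfolding cyc_weight_def by (intro prod_zero) auto
  then show ?thesis using False by simp
qed

text \<open>\<open>cyc_succ n\<close> moves 0, so it is replaced by the identity outside
  \<open>{1..n}\<close>, as \<open>permutes\<close> demands.\<close>

definition rot :: "nat \<Rightarrow> nat \<Rightarrow> nat" where
  "rot n i = (if i \<in> {1..n} then cyc_succ n i else i)"

lemma cyc_succ_in: "n \<ge> 1 \<Longrightarrow> cyc_succ n i \<in> {1..n}"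
  by (simp add: cyc_succ_def Suc_leI)

lemma cyc_succ_eq: "i \<in> {1..n} \<Longrightarrow> cyc_succ n i = (if i = n then 1 else i + 1)"
  by (auto simp: cyc_succ_def)

lemma rot_permutes: "rot n permutes {1..n}"
proof (rule bij_imp_permutes)
  have "inj_on (rot n) {1..n}"
    by (auto simp: inj_on_def rot_def cyc_succ_eq split: if_splits)
  moreover have "rot n ` {1..n} \<subseteq> {1..n}"
    by (auto simp: rot_def cyc_succ_eq)
  ultimately show "bij_betw (rot n) {1..n} {1..n}"
    by (simp add: bij_betw_def endo_inj_surj)
qed (auto simp: rot_def)

lemma cyc_weight_rot: "cyc_weight n (\<pi> \<circ> rot n) = cyc_weight n \<pi>"
proof -
  let ?t = "\<lambda>i. triple_weight (\<pi> i) (\<pi> (cyc_succ n i)) (\<pi> (cyc_succ n (cyc_succ n i)))"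
  have "cyc_weight n (\<pi> \<circ> rot n) = (\<Prod>i\<in>{1..n}. ?t (rot n i))"
    unfolding cyc_weight_def using cyc_succ_in
    by (intro prod.cong) (auto simp: rot_def)
  also have "\<dots> = (\<Prod>i\<in>{1..n}. ?t i)"
    by (rule prod.reindex_bij_betw[OF permutes_imp_bij[OF rot_permutes]])
  finally show ?thesis by (simp add: cyc_weight_def)
qed

text \<open>Composition with \<open>rot n\<close> moves the value \<open>m\<close> one position to
  the left and keeps the cyclic weight.\<close>

lemma sum_cyc_weight_shift:
  assumes "j \<in> {1..<n}"
  shows "(\<Sum>\<pi> | \<pi> permutes {1..n} \<and> \<pi> (Suc j) = m. cyc_weight n \<pi>) =
         (\<Sum>\<pi> | \<pi> permutes {1..n} \<and> \<pi> j = m. cyc_weight n \<pi>)"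
proof (rule sum.reindex_bij_witness[where i = "\<lambda>\<pi>. \<pi> \<circ> inv (rot n)" and j = "\<lambda>\<pi>. \<pi> \<circ> rot n"])
  note p = rot_permutes[of n]
  have j: "rot n j = Suc j" using assms by (simp add: rot_def cyc_succ_eq)
  then have j': "inv (rot n) (Suc j) = j" using permutes_inverses(2)[OF p, of j] by simp
  fix \<pi> :: "nat \<Rightarrow> nat"
  show "\<pi> \<circ> rot n \<circ> inv (rot n) = \<pi>" "\<pi> \<circ> inv (rot n) \<circ> rot n = \<pi>"
    using permutes_inv_o[OF p] by (simp_all add: comp_assoc)
  show "\<pi> \<in> {\<pi>. \<pi> permutes {1..n} \<and> \<pi> (Suc j) = m} \<Longrightarrow>
      \<pi> \<circ> rot n \<in> {\<pi>. \<pi> permutes {1..n} \<and> \<pi> j = m}"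
    using p j by (auto intro: permutes_compose)
  show "\<pi> \<in> {\<pi>. \<pi> permutes {1..n} \<and> \<pi> j = m} \<Longrightarrow>
      \<pi> \<circ> inv (rot n) \<in> {\<pi>. \<pi> permutes {1..n} \<and> \<pi> (Suc j) = m}"
    using permutes_inv[OF p] j' by (auto intro: permutes_compose)
qed (rule cyc_weight_rot)

section \<open>Cutting the cycle at its maximum\<close>

text \<open>The cycle is cut open at its letter \<open>n\<close>, which is written at both ends. The
  only cyclic triple lost is the one centred at \<open>n\<close>, a peak of weight 1 if
  \<open>n > 1\<close>.\<close>

lemma cyc_weight_eq_list_weight:
  assumes "\<pi> permutes {1..<n}" "n \<ge> 1"
  shows "cyc_weight n \<pi> = list_weight (n # map \<pi> [1..<n] @ [n])"
proof -
  have fix_n: "\<pi> n = n" using assms by (simp add: permutes_not_in)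
  have le: "\<pi> i \<le> n" if "i \<in> {1..n}" for i
    using that permutes_in_image[OF assms(1), of i] fix_n by (cases "i = n") auto
  show ?thesis
  proof (cases "n = 1")
    case True
    then show ?thesis using fix_n by (simp add: cyc_weight_def cyc_succ_def triple_weight_def)
  next
    case False
    then obtain k where n: "n = Suc (Suc k)" using assms(2) by (metis One_nat_def Suc_le_D old.nat.exhaust)
    \<comment> \<open>Index 0 holds the second copy of \<open>n\<close>, so the linear triple
      starting at 0 is the cyclic triple starting at \<open>n\<close>.\<close>
    define h where "h i = (if i = 0 then n else \<pi> i)" for i
    let ?t = "\<lambda>i. triple_weight (\<pi> i) (\<pi> (cyc_succ n i)) (\<pi> (cyc_succ n (cyc_succ n i)))"
    let ?s = "\<lambda>i. triple_weight (h i) (h (i + 1)) (h (i + 2))"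
    have "[0..<0 + Suc n] = 0 # [1..<n] @ [n]"
      using n upt_conv_Cons[of 0 n] by simp
    then have "n # map \<pi> [1..<n] @ [n] = map h [0..<0 + Suc n]"
      using n fix_n by (simp add: h_def)
    then have "list_weight (n # map \<pi> [1..<n] @ [n]) = (\<Prod>i = 0..<Suc k. ?s i)"
      unfolding list_weight_map_upt n by (simp only: list_weight_map_upt) simp
    also have "\<dots> = ?s 0 * (\<Prod>i = 1..k. ?s i)"
      by (subst prod.atLeast_Suc_lessThan) (auto simp: atLeastLessThanSuc_atLeastAtMost)
    also have "?s 0 = ?t n"
      using n fix_n by (simp add: h_def cyc_succ_eq)
    also have "(\<Prod>i = 1..k. ?s i) = (\<Prod>i = 1..k. ?t i)"
      using n by (intro prod.cong) (auto simp: h_def cyc_succ_eq)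
    finally have *: "list_weight (n # map \<pi> [1..<n] @ [n]) = ?t n * (\<Prod>i = 1..k. ?t i)" .
    \<comment> \<open>The lost triple: it starts at position \<open>n - 1 = Suc k\<close>.\<close>
    have "?t (Suc k) = triple_weight (\<pi> (Suc k)) n (\<pi> 1)"
      using n fix_n by (simp add: cyc_succ_eq)
    also have "\<dots> = 1"
      using le[of "Suc k"] le[of 1] n by (simp add: triple_weight_def)
    finally have "?t (Suc k) = 1" .
    then show ?thesis unfolding * unfolding cyc_weight_def n by simp
  qed
qed

lemma sum_cyc_weight_max_last:
  assumes "n \<ge> 1"
  shows "(\<Sum>\<pi> | \<pi> permutes {1..n} \<and> \<pi> n = n. cyc_weight n \<pi>) = fact (n - 1)"
proof -
  have "{\<pi>. \<pi> permutes {1..n} \<and> \<pi> n = n} = {\<pi>. \<pi> permutes {1..<n}}"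
  proof (intro equalityI subsetI CollectI; elim CollectE conjE)
    fix \<pi> assume "\<pi> permutes {1..n}" "\<pi> n = n"
    show "\<pi> permutes {1..<n}"
      by (rule permutes_superset[OF \<open>\<pi> permutes {1..n}\<close>]) (use \<open>\<pi> n = n\<close> in \<open>auto simp: le_less\<close>)
  next
    fix \<pi> assume "\<pi> permutes {1..<n}"
    then show "\<pi> permutes {1..n} \<and> \<pi> n = n"
      by (auto simp: permutes_not_in intro: permutes_subset)
  qed
  then have "(\<Sum>\<pi> | \<pi> permutes {1..n} \<and> \<pi> n = n. cyc_weight n \<pi>) =
      (\<Sum>\<pi> | \<pi> permutes {1..<n}. list_weight (n # map \<pi> [1..<n] @ [n]))"
    using cyc_weight_eq_list_weight[OF _ assms] by (intro sum.cong) simp_all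
  also have "\<dots> = (\<Sum>w\<in>permutations_of_set {1..<n}. list_weight (n # w @ [n]))"
    using sum.reindex_bij_betw[OF bij_betw_map_permutes[of "[1..<n]"],
        of "\<lambda>w. list_weight (n # w @ [n])"] by simp
  also have "\<dots> = fact (n - 1)"
    using sum_list_weight_permutations_of_set[of "{1..<n}" n] by simp
  finally show ?thesis .
qed

theorem theorem3p4:
  fixes n :: nat
  assumes "n \<ge> 1"
  shows "(\<Sum>\<pi> | \<pi> permutes {1..n} \<and> cyclically_123_avoiding n \<pi>.
            (2::nat) ^ cyc_double_descents n \<pi>) = fact n"
proof -
  let ?P = "{\<pi>. \<pi> permutes {1..n}}"
  let ?S = "\<lambda>j. \<Sum>\<pi> | \<pi> permutes {1..n} \<and> \<pi> j = n. cyc_weight n \<pi>"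
  have fin: "finite ?P" by (simp add: finite_permutations)
  have S: "?S j = fact (n - 1)" if "j \<in> {1..n}" for j
  proof -
    \<comment> \<open>Downward induction on \<open>j\<close> from \<open>n\<close>: rotation carries
      the value known for the last position to all others.\<close>
    have "j \<le> n" using that by simp
    then show ?thesis
      using that
    proof (induction rule: inc_induct)
      case base
      show ?case by (rule sum_cyc_weight_max_last[OF assms])
    next
      case (step m)
      then show ?case using sum_cyc_weight_shift[of m n n] by simp
    qed
  qed
  have "(\<Sum>\<pi> | \<pi> permutes {1..n} \<and> cyclically_123_avoiding n \<pi>.
            (2::nat) ^ cyc_double_descents n \<pi>) = (\<Sum>\<pi>\<in>?P. cyc_weight n \<pi>)"
    using sum.inter_filter[OF fin, of "\<lambda>\<pi>. (2::nat) ^ cyc_double_descents n \<pi>"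
        "cyclically_123_avoiding n"] by (simp add: cyc_weight_eq)
  \<comment> \<open>The permutations are grouped by the position \<open>inv \<pi> n\<close> of the
    letter \<open>n\<close>.\<close>
  also have "\<dots> = (\<Sum>j\<in>{1..n}. \<Sum>\<pi> | \<pi> \<in> ?P \<and> inv \<pi> n = j. cyc_weight n \<pi>)"
  proof (rule sum.group[symmetric])
    show "(\<lambda>\<pi>. inv \<pi> n) ` ?P \<subseteq> {1..n}"
      using assms permutes_in_image[OF permutes_inv, of _ "{1..n}" n] by auto
  qed (use fin in auto)
  also have "\<dots> = (\<Sum>j\<in>{1..n}. ?S j)"
    by (intro sum.cong refl) (auto simp: permutes_inv_eq permutes_inverses)
  also have "\<dots> = n * fact (n - 1)" using S by simp
  also have "\<dots> = fact n" using assms by (simp add: fact_reduce)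
  finally show ?thesis .
qed

end
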